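(* Let $\Omega\subset\mathbb{R}^2$ be a bounded domain with Lipschitz boundary. The functionals $\mathrm{TGV}$ and $\mathrm{TGVF}$ defined by $$\mathrm{TGV}(u)=\inf_{w\in\mathcal{M}(\Omega,\mathbb{R}^2)}\|\nabla u-w\|_{\mathcal{M}(\Omega,\mathbb{R}^2)}+\|\mathcal{E}(w)\|_{\mathcal{M}(\Omega,\mathbb{R}^4)},$$ $$\mathrm{TGVF}(u)=\inf_{w\in\mathcal{M}(\Omega,\mathbb{R}^2)}\|\nabla u-w\|_{\mathcal{M}(\Omega,\mathbb{R}^2)}+\|\nabla w\|_{\mathcal{M}(\Omega,\mathbb{R}^4)}$$ are special cases of $R_{\bm\beta}$: one has $\mathrm{TGV}=R_{\bm\beta}$ for ${\bm\beta}=(0,\frac1{\sqrt2},\frac1{\sqrt2},\frac1{\sqrt2})$, and $\mathrm{TGVF}=R_{\bm\beta}$ for ${\bm\beta}=(\frac1{\sqrt2},\frac1{\sqrt2},\frac1{\sqrt2},\frac1{\sqrt2})$.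
   Context: $\mathcal{M}(\Omega,\mathbb{R}^d)$ is the space of finite $\mathbb{R}^d$-valued Radon measures on $\Omega$ with the dual norm $\|\mu\|_{\mathcal{M}(\Omega,\mathbb{R}^d)}=\sup\{\sum_{i=1}^d\int_\Omega\varphi_i\,d\mu_i:\varphi\in C_0(\Omega,\mathbb{R}^d),\ \|\varphi\|_\infty\le1\}$, where $\|\varphi\|_\infty$ is the supremum of the pointwise Euclidean norm. The norm is set to $+\infty$ for distributions that are not finite Radon measures. $\nabla u$ is the distributional gradient. For $w=(w_1,w_2)\in\mathcal{M}(\Omega,\mathbb{R}^2)$, with derivatives in the sense of distributions, $\mathcal{E}(w)=\left(\partial_{x_1}w_1,\tfrac12(\partial_{x_2}w_1+\partial_{x_1}w_2),\tfrac12(\partial_{x_2}w_1+\partial_{x_1}w_2),\partial_{x_2}w_2\right)^\top$ and $\nabla w=(\partial_{x_1}w_1,\partial_{x_2}w_1,\partial_{x_1}w_2,\partial_{x_2}w_2)^\top$ are the vectorised symmetric and full gradients; further $\mathrm{curl}(w)=\partial_{x_1}w_2-\partial_{x_2}w_1$, $\mathrm{div}(w)=\partial_{x_1}w_1+\partial_{x_2}w_2$, $\mathrm{sh}_1(w)=\partial_{x_2}w_2-\partial_{x_1}w_1$, $\mathrm{sh}_2(w)=\partial_{x_2}w_1+\partial_{x_1}w_2$, and $\nabla_Nw=(\mathrm{curl}(w),\mathrm{div}(w),\mathrm{sh}_1(w),\mathrm{sh}_2(w))^\top$. For a vector ${\bm\beta}\in[0,\infty)^4$, $$R_{\bm\beta}(u)=\inf_{w\in\mathcal{M}(\Omega,\mathbb{R}^2)}\|\nabla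 u-w\|_{\mathcal{M}(\Omega,\mathbb{R}^2)}+\|\mathrm{diag}({\bm\beta})\nabla_Nw\|_{\mathcal{M}(\Omega,\mathbb{R}^4)}.$$ *)

theory Defs
  imports "HOL-Analysis.Analysis"
begin

section \<open>Bounded Lipschitz domains in the plane\<close>

definition is_domain :: "(real^2) set \<Rightarrow> bool" where
  "is_domain \<Omega> \<longleftrightarrow> open \<Omega> \<and> connected \<Omega> \<and> \<Omega> \<noteq> {}"

text \<open>Near every boundary point, after an orthogonal change of coordinates, the domain is the part
  of a ball lying strictly above the graph of a Lipschitz function.\<close>

definition lipschitz_boundary :: "(real^2) set \<Rightarrow> bool" where
  "lipschitz_boundary \<Omega> \<longleftrightarrow>
     (\<forall>p\<in>frontier \<Omega>. \<exists>r>0. \<exists>(Q :: real^2 \<Rightarrow> real^2) (\<gamma> :: real \<Rightarrow> real) L.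
        orthogonal_transformation Q \<and> L-lipschitz_on UNIV \<gamma> \<and>
        \<Omega> \<inter> ball p r = {x \<in> ball p r. \<gamma> (Q x $ 1) < Q x $ 2})"

section \<open>Test functions and distributions\<close>

definition pd :: "2 \<Rightarrow> (real^2 \<Rightarrow> real) \<Rightarrow> real^2 \<Rightarrow> real" where
  "pd i \<phi> x = frechet_derivative \<phi> (at x) (axis i 1)"

fun pds :: "2 list \<Rightarrow> (real^2 \<Rightarrow> real) \<Rightarrow> real^2 \<Rightarrow> real" where
  "pds [] \<phi> = \<phi>"
| "pds (i # is) \<phi> = pd i (pds is \<phi>)"

definition smooth :: "(real^2 \<Rightarrow> real) \<Rightarrow> bool" where
  "smooth \<phi> \<longleftrightarrow> (\<forall>is x. pds is \<phi> differentiable (at x))"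

definition fsupport :: "(real^2 \<Rightarrow> real) \<Rightarrow> (real^2) set" where
  "fsupport \<phi> = closure {x. \<phi> x \<noteq> 0}"

text \<open>Elements of $C_c^\infty(\Omega)$ are represented by their extension by zero to the plane.\<close>

definition test_fun :: "(real^2) set \<Rightarrow> (real^2 \<Rightarrow> real) set" where
  "test_fun \<Omega> = {\<phi>. smooth \<phi> \<and> compact (fsupport \<phi>) \<and> fsupport \<phi> \<subseteq> \<Omega>}"

text \<open>A distribution is a map on functions of which only the values on test functions matter;
  a vector of distributions is a map into \<open>real^'d\<close>, read componentwise.\<close>

type_synonym dist = "(real^2 \<Rightarrow> real) \<Rightarrow> real"
type_synonym 'd vdist = "(real^2 \<Rightarrow> real) \<Rightarrow> real^'d"

definition distribution :: "(real^2) set \<Rightarrow> dist \<Rightarrow> bool" where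
  "distribution \<Omega> T \<longleftrightarrow>
     (\<forall>\<phi>\<in>test_fun \<Omega>. \<forall>\<psi>\<in>test_fun \<Omega>. T (\<lambda>x. \<phi> x + \<psi> x) = T \<phi> + T \<psi>) \<and>
     (\<forall>c. \<forall>\<phi>\<in>test_fun \<Omega>. T (\<lambda>x. c * \<phi> x) = c * T \<phi>) \<and>
     (\<forall>K. compact K \<and> K \<subseteq> \<Omega> \<longrightarrow>
        (\<exists>C N. \<forall>\<phi>\<in>test_fun \<Omega>. fsupport \<phi> \<subseteq> K \<longrightarrow>
           \<bar>T \<phi>\<bar> \<le> C * (\<Sum>is\<in>{is. length is \<le> N}. SUP x. \<bar>pds is \<phi> x\<bar>)))"

definition ddx :: "2 \<Rightarrow> dist \<Rightarrow> dist" where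
  "ddx i T \<phi> = - T (pd i \<phi>)"

definition component :: "('d::finite) vdist \<Rightarrow> 'd \<Rightarrow> dist" where
  "component T i \<phi> = T \<phi> $ i"

section \<open>Finite vector-valued Radon measures\<close>

abbreviation borel_sets :: "(real^2) set \<Rightarrow> (real^2) set set" where
  "borel_sets \<Omega> \<equiv> sets (restrict_space borel \<Omega>)"

text \<open>Countably additive \<open>real^'d\<close>-valued set functions on the Borel sets of $\Omega$; values elsewhere
  are irrelevant.  For open $\Omega$ regularity is automatic, so these are the finite Radon measures.\<close>

definition radon_measure :: "(real^2) set \<Rightarrow> ((real^2) set \<Rightarrow> real^('d::finite)) \<Rightarrow> bool" where
  "radon_measure \<Omega> \<mu> \<longleftrightarrow>
     (\<forall>A :: nat \<Rightarrow> (real^2) set. range A \<subseteq> borel_sets \<Omega> \<and> disjoint_family A \<longrightarrow>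
        (\<lambda>n. \<mu> (A n)) sums \<mu> (\<Union>n. A n))"

text \<open>The positive part of the Jordan decomposition of a signed measure.  Taking \<open>B = {}\<close> shows that
  the truncation of negative values by \<open>ennreal\<close> does not change the supremum.\<close>

definition pos_part :: "(real^2) set \<Rightarrow> ((real^2) set \<Rightarrow> real) \<Rightarrow> (real^2) measure" where
  "pos_part \<Omega> \<nu> = measure_of \<Omega> (borel_sets \<Omega>)
     (\<lambda>A. SUP B\<in>{B \<in> borel_sets \<Omega>. B \<subseteq> A}. ennreal (\<nu> B))"

definition signed_integral ::
    "(real^2) set \<Rightarrow> ((real^2) set \<Rightarrow> real) \<Rightarrow> (real^2 \<Rightarrow> real) \<Rightarrow> real" where
  "signed_integral \<Omega> \<nu> f =
     integral\<^sup>L (pos_part \<Omega> \<nu>) f - integral\<^sup>L (pos_part \<Omega> (\<lambda>A. - \<nu> A)) f"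

text \<open>$C_0(\Omega,\mathbb{R}^d)$, continuous functions on $\Omega$ vanishing at infinity.\<close>

definition C0 :: "(real^2) set \<Rightarrow> (real^2 \<Rightarrow> real^('d::finite)) set" where
  "C0 \<Omega> = {\<phi>. continuous_on \<Omega> \<phi> \<and> (\<forall>\<epsilon>>0. compact {x\<in>\<Omega>. \<epsilon> \<le> norm (\<phi> x)})}"

definition measure_norm :: "(real^2) set \<Rightarrow> ((real^2) set \<Rightarrow> real^('d::finite)) \<Rightarrow> ereal" where
  "measure_norm \<Omega> \<mu> =
     (SUP \<phi>\<in>{\<phi> \<in> C0 \<Omega>. \<forall>x\<in>\<Omega>. norm (\<phi> x) \<le> 1}.
        ereal (\<Sum>i\<in>UNIV. signed_integral \<Omega> (\<lambda>A. \<mu> A $ i) (\<lambda>x. \<phi> x $ i)))"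

definition dist_of :: "(real^2) set \<Rightarrow> ((real^2) set \<Rightarrow> real^('d::finite)) \<Rightarrow> 'd vdist" where
  "dist_of \<Omega> \<mu> \<phi> = (\<chi> i. signed_integral \<Omega> (\<lambda>A. \<mu> A $ i) \<phi>)"

text \<open>The norm of a vector of distributions.  A finite Radon measure inducing \<open>T\<close> is unique (on Borel
  sets) if it exists, so the infimum is over at most one value; it is \<open>\<infinity>\<close> if there is none.\<close>

definition dist_norm :: "(real^2) set \<Rightarrow> ('d::finite) vdist \<Rightarrow> ereal" where
  "dist_norm \<Omega> T =
     (INF \<mu>\<in>{\<mu>. radon_measure \<Omega> \<mu> \<and> (\<forall>\<phi>\<in>test_fun \<Omega>. T \<phi> = dist_of \<Omega> \<mu> \<phi>)}.
        measure_norm \<Omega> \<mu>)"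

section \<open>Differential operators and the functionals\<close>

definition grad :: "dist \<Rightarrow> 2 vdist" where
  "grad u \<phi> = vector [ddx 1 u \<phi>, ddx 2 u \<phi>]"

definition sym_grad :: "2 vdist \<Rightarrow> 4 vdist" where
  "sym_grad w \<phi> = vector
     [ddx 1 (component w 1) \<phi>,
      1/2 * (ddx 2 (component w 1) \<phi> + ddx 1 (component w 2) \<phi>),
      1/2 * (ddx 2 (component w 1) \<phi> + ddx 1 (component w 2) \<phi>),
      ddx 2 (component w 2) \<phi>]"

definition full_grad :: "2 vdist \<Rightarrow> 4 vdist" where
  "full_grad w \<phi> = vector
     [ddx 1 (component w 1) \<phi>, ddx 2 (component w 1) \<phi>, ddx 1 (component w 2) \<phi>, ddx 2 (component w 2) \<phi>]"

definition dcurl :: "2 vdist \<Rightarrow> dist" where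
  "dcurl w \<phi> = ddx 1 (component w 2) \<phi> - ddx 2 (component w 1) \<phi>"

definition ddiv :: "2 vdist \<Rightarrow> dist" where
  "ddiv w \<phi> = ddx 1 (component w 1) \<phi> + ddx 2 (component w 2) \<phi>"

definition sh1 :: "2 vdist \<Rightarrow> dist" where
  "sh1 w \<phi> = ddx 2 (component w 2) \<phi> - ddx 1 (component w 1) \<phi>"

definition sh2 :: "2 vdist \<Rightarrow> dist" where
  "sh2 w \<phi> = ddx 2 (component w 1) \<phi> + ddx 1 (component w 2) \<phi>"

definition grad_N :: "2 vdist \<Rightarrow> 4 vdist" where
  "grad_N w \<phi> = vector [dcurl w \<phi>, ddiv w \<phi>, sh1 w \<phi>, sh2 w \<phi>]"

definition diag :: "real^('d::finite) \<Rightarrow> real^'d^'d" where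
  "diag \<beta> = (\<chi> i j. if i = j then \<beta> $ i else 0)"

definition R :: "(real^2) set \<Rightarrow> real^4 \<Rightarrow> dist \<Rightarrow> ereal" where
  "R \<Omega> \<beta> u = (INF w\<in>{w :: (real^2) set \<Rightarrow> real^2. radon_measure \<Omega> w}.
     dist_norm \<Omega> (\<lambda>\<phi>. grad u \<phi> - dist_of \<Omega> w \<phi>) +
     dist_norm \<Omega> (\<lambda>\<phi>. diag \<beta> *v grad_N (dist_of \<Omega> w) \<phi>))"

definition TGV :: "(real^2) set \<Rightarrow> dist \<Rightarrow> ereal" where
  "TGV \<Omega> u = (INF w\<in>{w :: (real^2) set \<Rightarrow> real^2. radon_measure \<Omega> w}.
     dist_norm \<Omega> (\<lambda>\<phi>. grad u \<phi> - dist_of \<Omega> w \<phi>) +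
     dist_norm \<Omega> (sym_grad (dist_of \<Omega> w)))"

definition TGVF :: "(real^2) set \<Rightarrow> dist \<Rightarrow> ereal" where
  "TGVF \<Omega> u = (INF w\<in>{w :: (real^2) set \<Rightarrow> real^2. radon_measure \<Omega> w}.
     dist_norm \<Omega> (\<lambda>\<phi>. grad u \<phi> - dist_of \<Omega> w \<phi>) +
     dist_norm \<Omega> (full_grad (dist_of \<Omega> w)))"

end

theory Submission
  imports Defs
begin

text \<open>
  The three second-order terms are linked by one fixed orthogonal map of \<open>real^4\<close>, the space of
  gradients.  Up to the factor \<open>1 / sqrt 2\<close>, curl, divergence and the two shears are sums and
  differences of two partial derivatives each, and the resulting matrix \<open>natural_matrix\<close> is
  orthogonal.  It sends \<open>full_grad w\<close> to \<open>diag \<beta> *v grad_N w\<close> with all entries of \<open>\<beta>\<close> equal to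
  \<open>1 / sqrt 2\<close>.  The same matrix applied to the symmetrised gradient gives the same vector with
  its curl entry replaced by \<open>0\<close>, since the curl row is the difference of the two mixed entries,
  which coincide after symmetrisation (lemmas \<open>natural_matrix_full_grad\<close> and
  \<open>natural_matrix_sym_grad\<close>).

  It remains to see that the norm of a vector of distributions is invariant under orthogonal
  matrices (lemma \<open>dist_norm_matrix\<close>).  If \<open>\<mu>\<close> represents \<open>T\<close>, then \<open>Q \<mu>\<close> represents \<open>Q T\<close>, and
  pairing \<open>Q \<mu>\<close> with \<open>\<phi>\<close> is pairing \<open>\<mu>\<close> with \<open>Q\<^sup>T \<phi>\<close>, which has the same pointwise Euclidean
  norm.  Both facts use that the integral of a bounded function against a signed measure is
  bilinear.  Linearity in the measure is the delicate half: the integral is defined through the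
  Jordan decomposition, and positive parts do not add up.  It is obtained by showing that the
  positive part is a finite measure, that \<open>\<nu>\<close> is the difference of its two parts
  (\<open>Jordan_decomposition\<close>), and that the integral is therefore a limit of finite sums
  \<open>\<Sum> y * \<nu> {x. s x = y}\<close> over simple functions \<open>s\<close> that do not depend on \<open>\<nu>\<close>
  (\<open>signed_integral_approx\<close>).  Such sums are visibly linear in \<open>\<nu>\<close>.
\<close>

section \<open>Signed measures and their Jordan decomposition\<close>

definition signed_measure :: "(real^2) set \<Rightarrow> ((real^2) set \<Rightarrow> real) \<Rightarrow> bool" where
  "signed_measure \<Omega> \<nu> \<longleftrightarrow>
     (\<forall>A :: nat \<Rightarrow> (real^2) set. range A \<subseteq> borel_sets \<Omega> \<and> disjoint_family A \<longrightarrow>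
        (\<lambda>n. \<nu> (A n)) sums \<nu> (\<Union>n. A n))"

lemma signed_measureI:
  "(\<And>A. \<lbrakk>\<And>n. A n \<in> borel_sets \<Omega>; disjoint_family A\<rbrakk>
      \<Longrightarrow> (\<lambda>n. \<nu> (A n)) sums \<nu> (\<Union>n::nat. A n))
    \<Longrightarrow> signed_measure \<Omega> \<nu>"
  by (simp add: signed_measure_def image_subset_iff)

lemma signed_measureD:
  "\<lbrakk>signed_measure \<Omega> \<nu>; \<And>n. A n \<in> borel_sets \<Omega>; disjoint_family A\<rbrakk>
    \<Longrightarrow> (\<lambda>n. \<nu> (A n)) sums \<nu> (\<Union>n::nat. A n)"
  by (simp add: signed_measure_def image_subset_iff)

lemma signed_measure_uminus:
  "signed_measure \<Omega> \<nu> \<Longrightarrow> signed_measure \<Omega> (\<lambda>A. - \<nu> A)"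
proof (rule signed_measureI, rule sums_minus)
  fix A :: "nat \<Rightarrow> (real^2) set"
  assume "signed_measure \<Omega> \<nu>" "\<And>n. A n \<in> borel_sets \<Omega>" "disjoint_family A"
  then show "(\<lambda>n. \<nu> (A n)) sums \<nu> (\<Union>n. A n)"
    by (simp add: signed_measureD[of \<Omega> \<nu> A])
qed

lemma borel_sets_subset: "A \<in> borel_sets \<Omega> \<Longrightarrow> A \<subseteq> \<Omega>"
  using sets.sets_into_space[of A "restrict_space borel \<Omega>"] by (simp add: space_restrict_space)

lemma Omega_in_borel_sets: "\<Omega> \<in> borel_sets \<Omega>"
  using sets.top[of "restrict_space borel \<Omega>"] by (simp add: space_restrict_space)

lemma signed_measure_empty:
  assumes "signed_measure \<Omega> \<nu>"
  shows "\<nu> {} = 0"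
proof -
  have "(\<lambda>n::nat. \<nu> {}) sums \<nu> (\<Union>n::nat. {})"
    by (rule signed_measureD[OF assms]) (auto simp: disjoint_family_on_def)
  then have "summable (\<lambda>n::nat. \<nu> {})" by (rule sums_summable)
  then show ?thesis by (simp add: summable_const_iff)
qed

lemma signed_measure_Un:
  assumes "signed_measure \<Omega> \<nu>" "A \<in> borel_sets \<Omega>" "B \<in> borel_sets \<Omega>" "A \<inter> B = {}"
  shows "\<nu> (A \<union> B) = \<nu> A + \<nu> B"
proof -
  have "(\<lambda>n. \<nu> (binaryset A B n)) sums \<nu> (\<Union>n. binaryset A B n)"
    using assms by (intro signed_measureD) (auto simp: binaryset_def disjoint_family_on_def)
  then have "(\<lambda>n. \<nu> (binaryset A B n)) sums \<nu> (A \<union> B)"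
    by (simp add: UN_binaryset_eq)
  moreover have "(\<lambda>n. \<nu> (binaryset A B n)) sums (\<nu> A + \<nu> B)"
    by (rule binaryset_sums) (rule signed_measure_empty[OF assms(1)])
  ultimately show ?thesis by (rule sums_unique2)
qed

lemma signed_measure_Diff:
  assumes "signed_measure \<Omega> \<nu>" "A \<in> borel_sets \<Omega>" "B \<in> borel_sets \<Omega>" "B \<subseteq> A"
  shows "\<nu> (A - B) = \<nu> A - \<nu> B"
proof -
  have "(A - B) \<union> B = A" "(A - B) \<inter> B = {}" using assms(4) by auto
  with signed_measure_Un[OF assms(1), of "A - B" B] assms(2,3) show ?thesis by auto
qed

text \<open>This is the property carried along in the exhaustion argument which shows that a real-valued
  countably additive set function is bounded.\<close>

definition unbounded_above_within :: "(real^2) set \<Rightarrow> ((real^2) set \<Rightarrow> real) \<Rightarrow> (real^2) set \<Rightarrow> bool" where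
  "unbounded_above_within \<Omega> \<nu> E \<longleftrightarrow> (\<forall>K. \<exists>B\<in>borel_sets \<Omega>. B \<subseteq> E \<and> \<nu> B > K)"

text \<open>A piece \<open>B\<close> with \<open>\<nu> B\<close> far above \<open>\<bar>\<nu> E\<bar>\<close> leaves a complement of measure below \<open>- 1\<close>, so
  both pieces have measure at least \<open>1\<close> in absolute value.  One of the two inherits unboundedness,
  whichever it is.\<close>

lemma unbounded_above_within_split:
  assumes \<nu>: "signed_measure \<Omega> \<nu>" and E: "E \<in> borel_sets \<Omega>" and unb: "unbounded_above_within \<Omega> \<nu> E"
  shows "\<exists>F\<in>borel_sets \<Omega>. F \<subseteq> E \<and> unbounded_above_within \<Omega> \<nu> F \<and> \<bar>\<nu> (E - F)\<bar> \<ge> 1"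
proof -
  obtain B where B: "B \<in> borel_sets \<Omega>" "B \<subseteq> E" "\<nu> B > \<bar>\<nu> E\<bar> + 1"
    using unb unfolding unbounded_above_within_def by blast
  have EB: "\<nu> (E - B) = \<nu> E - \<nu> B" by (rule signed_measure_Diff[OF \<nu> E B(1,2)])
  have "unbounded_above_within \<Omega> \<nu> B \<or> unbounded_above_within \<Omega> \<nu> (E - B)"
  proof (rule ccontr)
    assume "\<not> ?thesis"
    then obtain K L where K: "\<And>C. C \<in> borel_sets \<Omega> \<Longrightarrow> C \<subseteq> B \<Longrightarrow> \<nu> C \<le> K"
      and L: "\<And>C. C \<in> borel_sets \<Omega> \<Longrightarrow> C \<subseteq> E - B \<Longrightarrow> \<nu> C \<le> L"
      unfolding unbounded_above_within_def by (meson not_less)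
    obtain C where C: "C \<in> borel_sets \<Omega>" "C \<subseteq> E" "\<nu> C > K + L"
      using unb unfolding unbounded_above_within_def by blast
    have "\<nu> C = \<nu> (C \<inter> B) + \<nu> (C - B)"
      using signed_measure_Un[OF \<nu>, of "C \<inter> B" "C - B"] C B by (auto simp: Int_Diff_Un)
    also have "\<dots> \<le> K + L"
      using C B by (intro add_mono K L) auto
    finally show False using C by simp
  qed
  then show ?thesis
  proof
    assume "unbounded_above_within \<Omega> \<nu> B"
    then show ?thesis using B EB by (intro bexI[of _ B]) auto
  next
    assume "unbounded_above_within \<Omega> \<nu> (E - B)"
    moreover have "E - (E - B) = B" using B by blast
    ultimately show ?thesis using B E by (intro bexI[of _ "E - B"]) auto
  qed
qed

text \<open>Were the values unbounded, repeated splitting would produce disjoint sets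
  \<open>F n - F (Suc n)\<close> of measure at least \<open>1\<close> in absolute value, whose measures cannot be summable.\<close>

lemma signed_measure_bounded_above:
  assumes \<nu>: "signed_measure \<Omega> \<nu>"
  shows "\<exists>K. \<forall>B\<in>borel_sets \<Omega>. \<nu> B \<le> K"
proof (rule ccontr)
  assume "\<not> ?thesis"
  then have unb: "unbounded_above_within \<Omega> \<nu> \<Omega>"
    unfolding unbounded_above_within_def by (meson borel_sets_subset not_less)
  have "\<exists>F. \<forall>n. (F n \<in> borel_sets \<Omega> \<and> unbounded_above_within \<Omega> \<nu> (F n)) \<and>
      (F (Suc n) \<subseteq> F n \<and> \<bar>\<nu> (F n - F (Suc n))\<bar> \<ge> 1)"
    using unb Omega_in_borel_sets unbounded_above_within_split[OF \<nu>]
    by (intro dependent_nat_choice) blast+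
  then obtain F where F: "\<And>n. F n \<in> borel_sets \<Omega>" "\<And>n. F (Suc n) \<subseteq> F n"
      "\<And>n. \<bar>\<nu> (F n - F (Suc n))\<bar> \<ge> 1"
    by blast
  have dec: "F n \<subseteq> F m" if "m \<le> n" for m n
    using lift_Suc_antimono_le[of F m n] F(2) that by blast
  have "disjoint_family (\<lambda>n. F n - F (Suc n))"
    unfolding disjoint_family_on_def
  proof (intro ballI impI)
    fix m n :: nat
    assume "m \<noteq> n"
    then show "(F m - F (Suc m)) \<inter> (F n - F (Suc n)) = {}"
      using dec[of "Suc m" n] dec[of "Suc n" m] by (cases m n rule: linorder_cases) auto
  qed
  then have "(\<lambda>n. \<nu> (F n - F (Suc n))) sums \<nu> (\<Union>n. F n - F (Suc n))"
    using F(1) by (intro signed_measureD[OF \<nu>]) auto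
  then have "(\<lambda>n. \<nu> (F n - F (Suc n))) \<longlonglongrightarrow> 0"
    by (intro summable_LIMSEQ_zero sums_summable)
  then obtain n where "\<bar>\<nu> (F n - F (Suc n))\<bar> < 1"
    unfolding lim_sequentially dist_real_def by (metis diff_zero order_refl zero_less_one)
  with F(3)[of n] show False by simp
qed

text \<open>The set function from which \<open>pos_part\<close> is generated, before it is known to be a measure.\<close>

definition upper_var :: "(real^2) set \<Rightarrow> ((real^2) set \<Rightarrow> real) \<Rightarrow> (real^2) set \<Rightarrow> ennreal" where
  "upper_var \<Omega> \<nu> A = (SUP B\<in>{B \<in> borel_sets \<Omega>. B \<subseteq> A}. ennreal (\<nu> B))"

lemma upper_var_upper: "\<lbrakk>B \<in> borel_sets \<Omega>; B \<subseteq> A\<rbrakk> \<Longrightarrow> ennreal (\<nu> B) \<le> upper_var \<Omega> \<nu> A"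
  unfolding upper_var_def by (rule SUP_upper) simp

lemma upper_var_least:
  "(\<And>B. \<lbrakk>B \<in> borel_sets \<Omega>; B \<subseteq> A\<rbrakk> \<Longrightarrow> ennreal (\<nu> B) \<le> c) \<Longrightarrow> upper_var \<Omega> \<nu> A \<le> c"
  unfolding upper_var_def by (rule SUP_least) simp

lemma upper_var_mono: "A \<subseteq> B \<Longrightarrow> upper_var \<Omega> \<nu> A \<le> upper_var \<Omega> \<nu> B"
  by (rule upper_var_least) (auto intro: upper_var_upper)

lemma upper_var_empty: "signed_measure \<Omega> \<nu> \<Longrightarrow> upper_var \<Omega> \<nu> {} = 0"
  using upper_var_least[of \<Omega> "{}" \<nu> 0] by (auto simp: signed_measure_empty)

lemma upper_var_superadditive:
  assumes \<nu>: "signed_measure \<Omega> \<nu>" and disj: "A \<inter> B = {}"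
  shows "upper_var \<Omega> \<nu> A + upper_var \<Omega> \<nu> B \<le> upper_var \<Omega> \<nu> (A \<union> B)"
proof -
  let ?S = "\<lambda>A. {C \<in> borel_sets \<Omega>. C \<subseteq> A}"
  have ne: "?S X \<noteq> {}" for X using sets.empty_sets by blast
  have *: "ennreal (\<nu> C) + ennreal (\<nu> D) \<le> upper_var \<Omega> \<nu> (A \<union> B)"
    if C: "C \<in> ?S A" and D: "D \<in> ?S B" for C D
  proof -
    consider "\<nu> C \<le> 0" | "\<nu> D \<le> 0" | "\<nu> C \<ge> 0" "\<nu> D \<ge> 0" by linarith
    then show ?thesis
    proof cases
      case 1
      then show ?thesis using upper_var_upper[of D \<Omega> "A \<union> B" \<nu>] D by (auto simp: ennreal_neg)
    next
      case 2
      then show ?thesis using upper_var_upper[of C \<Omega> "A \<union> B" \<nu>] C by (auto simp: ennreal_neg)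
    next
      case 3
      have "\<nu> (C \<union> D) = \<nu> C + \<nu> D"
        using C D disj by (intro signed_measure_Un[OF \<nu>]) auto
      then have "ennreal (\<nu> C) + ennreal (\<nu> D) = ennreal (\<nu> (C \<union> D))"
        using 3 by (simp add: ennreal_plus)
      also have "\<dots> \<le> upper_var \<Omega> \<nu> (A \<union> B)"
        using C D by (intro upper_var_upper) auto
      finally show ?thesis .
    qed
  qed
  have "upper_var \<Omega> \<nu> A + upper_var \<Omega> \<nu> B =
      (SUP C\<in>?S A. SUP D\<in>?S B. ennreal (\<nu> C) + ennreal (\<nu> D))"
    unfolding upper_var_def
    by (subst ennreal_SUP_add_left[OF ne, symmetric], subst ennreal_SUP_add_right[OF ne]) (rule refl)
  also have "\<dots> \<le> upper_var \<Omega> \<nu> (A \<union> B)"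
    by (intro SUP_least *)
  finally show ?thesis .
qed

text \<open>The series of truncated terms may diverge to \<open>\<infinity>\<close>, or be larger than the truncation of \<open>s\<close>
  because negative terms are dropped; hence only an inequality.\<close>

lemma ennreal_le_suminf_ennreal:
  assumes "x sums s"
  shows "ennreal s \<le> (\<Sum>n. ennreal (x n))"
proof (rule LIMSEQ_le_const2)
  show "(\<lambda>n. ennreal (\<Sum>i<n. x i)) \<longlonglongrightarrow> ennreal s"
    using assms unfolding sums_def by (rule tendsto_ennrealI)
  have "ennreal (\<Sum>i<n. x i) \<le> (\<Sum>n. ennreal (x n))" for n
  proof -
    have "ennreal (\<Sum>i<n. x i) \<le> ennreal (\<Sum>i<n. max 0 (x i))"
      by (intro ennreal_leI sum_mono) simp
    also have "\<dots> = (\<Sum>i<n. ennreal (x i))"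
      by (simp add: sum_ennreal[symmetric] ennreal_max_0)
    also have "\<dots> \<le> (\<Sum>n. ennreal (x n))"
      by (rule sum_le_suminf) auto
    finally show ?thesis .
  qed
  then show "\<exists>N. \<forall>n\<ge>N. ennreal (\<Sum>i<n. x i) \<le> (\<Sum>n. ennreal (x n))"
    by blast
qed

text \<open>Superadditivity bounds the finite partial sums from above.  Conversely, a competitor \<open>B\<close> for the
  union is cut into the competitors \<open>B \<inter> A i\<close>.\<close>

lemma upper_var_countably_additive:
  assumes \<nu>: "signed_measure \<Omega> \<nu>"
  shows "countably_additive (borel_sets \<Omega>) (upper_var \<Omega> \<nu>)"
  unfolding countably_additive_def
proof (intro allI impI antisym)
  fix A :: "nat \<Rightarrow> (real^2) set"
  assume "range A \<subseteq> borel_sets \<Omega>" and disj: "disjoint_family A"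
  then have A: "A i \<in> borel_sets \<Omega>" for i by blast
  have fin: "(\<Sum>i<n. upper_var \<Omega> \<nu> (A i)) \<le> upper_var \<Omega> \<nu> (\<Union>i<n. A i)" for n
  proof (induction n)
    case 0
    then show ?case by simp
  next
    case (Suc n)
    have "A i \<inter> A n = {}" if "i < n" for i
      using disjoint_family_onD[OF disj, of i n] that by simp
    then have disj_n: "(\<Union>i<n. A i) \<inter> A n = {}" by auto
    have "(\<Sum>i<Suc n. upper_var \<Omega> \<nu> (A i)) \<le> upper_var \<Omega> \<nu> (\<Union>i<n. A i) + upper_var \<Omega> \<nu> (A n)"
      using add_right_mono[OF Suc] by simp
    also have "\<dots> \<le> upper_var \<Omega> \<nu> ((\<Union>i<n. A i) \<union> A n)"
      by (rule upper_var_superadditive[OF \<nu> disj_n])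
    also have "(\<Union>i<n. A i) \<union> A n = (\<Union>i<Suc n. A i)"
      by (simp add: lessThan_Suc Un_commute)
    finally show ?case .
  qed
  show "(\<Sum>i. upper_var \<Omega> \<nu> (A i)) \<le> upper_var \<Omega> \<nu> (\<Union>i. A i)"
    by (rule suminf_le_const) (auto intro: order_trans[OF fin] upper_var_mono)
  show "upper_var \<Omega> \<nu> (\<Union>i. A i) \<le> (\<Sum>i. upper_var \<Omega> \<nu> (A i))"
  proof (rule upper_var_least)
    fix B assume B: "B \<in> borel_sets \<Omega>" "B \<subseteq> (\<Union>i. A i)"
    have "(\<lambda>i. \<nu> (B \<inter> A i)) sums \<nu> (\<Union>i. B \<inter> A i)"
      by (intro signed_measureD[OF \<nu>] sets.Int A B disjoint_family_subset[OF disj]) simp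
    moreover have "(\<Union>i. B \<inter> A i) = B" using B by blast
    ultimately have "ennreal (\<nu> B) \<le> (\<Sum>i. ennreal (\<nu> (B \<inter> A i)))"
      using ennreal_le_suminf_ennreal by metis
    also have "\<dots> \<le> (\<Sum>i. upper_var \<Omega> \<nu> (A i))"
      using A B by (intro suminf_le upper_var_upper) auto
    finally show "ennreal (\<nu> B) \<le> (\<Sum>i. upper_var \<Omega> \<nu> (A i))" .
  qed
qed

lemma sets_pos_part [measurable_cong]: "sets (pos_part \<Omega> \<nu>) = borel_sets \<Omega>"
  using sets.sigma_sets_eq[of "restrict_space borel \<Omega>"] sets.space_closed[of "restrict_space borel \<Omega>"]
  by (simp add: pos_part_def space_restrict_space)

lemma space_pos_part: "space (pos_part \<Omega> \<nu>) = \<Omega>"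
  using sets_eq_imp_space_eq[OF sets_pos_part] by (simp add: space_restrict_space)

lemma emeasure_pos_part:
  assumes \<nu>: "signed_measure \<Omega> \<nu>" and "A \<in> borel_sets \<Omega>"
  shows "emeasure (pos_part \<Omega> \<nu>) A = upper_var \<Omega> \<nu> A"
proof -
  have "sigma_algebra \<Omega> (borel_sets \<Omega>)"
    using sets.sigma_algebra_axioms[of "restrict_space borel \<Omega>"] by (simp add: space_restrict_space)
  moreover have "positive (borel_sets \<Omega>) (upper_var \<Omega> \<nu>)"
    by (simp add: positive_def upper_var_empty[OF \<nu>])
  ultimately show ?thesis
    using emeasure_measure_of_sigma[OF _ _ upper_var_countably_additive[OF \<nu>] assms(2)]
    by (simp add: pos_part_def upper_var_def[abs_def])
qed

lemma finite_measure_pos_part: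
  assumes \<nu>: "signed_measure \<Omega> \<nu>"
  shows "finite_measure (pos_part \<Omega> \<nu>)"
proof
  obtain K where "\<forall>B\<in>borel_sets \<Omega>. \<nu> B \<le> K"
    using signed_measure_bounded_above[OF \<nu>] by blast
  then have "upper_var \<Omega> \<nu> \<Omega> \<le> ennreal K"
    by (intro upper_var_least ennreal_leI) blast
  then have "upper_var \<Omega> \<nu> \<Omega> \<noteq> \<infinity>"
    using ennreal_less_top[of K] by (auto simp: top_unique)
  then show "emeasure (pos_part \<Omega> \<nu>) (space (pos_part \<Omega> \<nu>)) \<noteq> \<infinity>"
    by (simp add: space_pos_part emeasure_pos_part[OF \<nu> Omega_in_borel_sets])
qed

text \<open>For \<open>B \<subseteq> A\<close> one has \<open>\<nu> B = \<nu> A + (- \<nu> (A - B))\<close>, and the last term is at most the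
  value of the negative part at \<open>A\<close>.  Applied to \<open>\<nu>\<close> and to \<open>- \<nu>\<close>, the inequality gives the Jordan
  decomposition without a Hahn decomposition.\<close>

lemma measure_pos_part_le:
  assumes \<nu>: "signed_measure \<Omega> \<nu>" and A: "A \<in> borel_sets \<Omega>"
  shows "measure (pos_part \<Omega> \<nu>) A \<le> \<nu> A + measure (pos_part \<Omega> (\<lambda>A. - \<nu> A)) A"
proof -
  note \<nu>' = signed_measure_uminus[OF \<nu>]
  interpret P: finite_measure "pos_part \<Omega> \<nu>" by (rule finite_measure_pos_part[OF \<nu>])
  interpret N: finite_measure "pos_part \<Omega> (\<lambda>A. - \<nu> A)" by (rule finite_measure_pos_part[OF \<nu>'])
  let ?n = "measure (pos_part \<Omega> (\<lambda>A. - \<nu> A)) A"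
  have *: "\<nu> B \<le> \<nu> A + ?n" if B: "B \<in> borel_sets \<Omega>" "B \<subseteq> A" for B
  proof -
    have "ennreal (- \<nu> (A - B)) \<le> ennreal ?n"
      unfolding N.emeasure_eq_measure[symmetric] emeasure_pos_part[OF \<nu>' A]
      using A B by (intro upper_var_upper) auto
    then have "- \<nu> (A - B) \<le> ?n" by (simp add: ennreal_le_iff)
    then show ?thesis using signed_measure_Diff[OF \<nu> A B] by simp
  qed
  have "0 \<le> \<nu> A + ?n" using *[of "{}"] signed_measure_empty[OF \<nu>] by simp
  moreover have "upper_var \<Omega> \<nu> A \<le> ennreal (\<nu> A + ?n)"
    by (intro upper_var_least ennreal_leI *)
  ultimately show ?thesis
    unfolding emeasure_pos_part[OF \<nu> A, symmetric] P.emeasure_eq_measure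
    by (simp add: ennreal_le_iff)
qed

lemma Jordan_decomposition:
  assumes \<nu>: "signed_measure \<Omega> \<nu>" and A: "A \<in> borel_sets \<Omega>"
  shows "\<nu> A = measure (pos_part \<Omega> \<nu>) A - measure (pos_part \<Omega> (\<lambda>A. - \<nu> A)) A"
  using measure_pos_part_le[OF \<nu> A] measure_pos_part_le[OF signed_measure_uminus[OF \<nu>] A] by simp

section \<open>Bilinearity of the integral\<close>

definition bounded_measurable :: "(real^2) set \<Rightarrow> (real^2 \<Rightarrow> real) \<Rightarrow> bool" where
  "bounded_measurable \<Omega> f \<longleftrightarrow>
     f \<in> borel_measurable (restrict_space borel \<Omega>) \<and> (\<exists>K. \<forall>x\<in>\<Omega>. \<bar>f x\<bar> \<le> K)"

lemma bounded_measurable_integrable: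
  assumes "signed_measure \<Omega> \<nu>" "bounded_measurable \<Omega> f"
  shows "integrable (pos_part \<Omega> \<nu>) f"
proof -
  interpret finite_measure "pos_part \<Omega> \<nu>" by (rule finite_measure_pos_part) fact
  obtain K where "\<forall>x\<in>\<Omega>. \<bar>f x\<bar> \<le> K" "f \<in> borel_measurable (restrict_space borel \<Omega>)"
    using assms(2) unfolding bounded_measurable_def by blast
  then show ?thesis
    by (intro integrable_const_bound[where B=K])
      (auto simp: space_pos_part cong: measurable_cong_sets[OF sets_pos_part refl])
qed

lemma signed_integral_sum_fun:
  assumes \<nu>: "signed_measure \<Omega> \<nu>" and f: "\<And>i. i \<in> I \<Longrightarrow> bounded_measurable \<Omega> (f i)"
  shows "signed_integral \<Omega> \<nu> (\<lambda>x. \<Sum>i\<in>I. c i * f i x) = (\<Sum>i\<in>I. c i * signed_integral \<Omega> \<nu> (f i))"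
proof -
  have "integral\<^sup>L (pos_part \<Omega> \<nu>) (\<lambda>x. \<Sum>i\<in>I. c i * f i x)
      = (\<Sum>i\<in>I. c i * integral\<^sup>L (pos_part \<Omega> \<nu>) (f i))"
    if "signed_measure \<Omega> \<nu>" for \<nu>
    using bounded_measurable_integrable[OF that f] by (subst Bochner_Integration.integral_sum) auto
  from this[OF \<nu>] this[OF signed_measure_uminus[OF \<nu>]] show ?thesis
    by (simp add: signed_integral_def sum_subtractf[symmetric] right_diff_distrib)
qed

text \<open>The integral of a simple function \<open>s\<close> against \<open>\<nu>\<close>, written without the Jordan decomposition so
  that linearity in \<open>\<nu>\<close> is evident.\<close>

definition elementary_sum :: "(real^2) set \<Rightarrow> ((real^2) set \<Rightarrow> real) \<Rightarrow> (real^2 \<Rightarrow> real) \<Rightarrow> real" where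
  "elementary_sum \<Omega> \<nu> s = (\<Sum>y\<in>s ` \<Omega>. y * \<nu> {x \<in> \<Omega>. s x = y})"

text \<open>The order of the quantifiers is the point: one sequence of simple functions serves all \<open>\<nu>\<close>,
  because measurability of \<open>f\<close> refers only to the Borel sets of \<open>\<Omega>\<close>.  Dominated convergence
  applies to the positive and the negative part separately.\<close>

lemma signed_integral_approx:
  assumes f: "bounded_measurable \<Omega> f"
  shows "\<exists>s. \<forall>\<nu>. signed_measure \<Omega> \<nu> \<longrightarrow>
    (\<lambda>n::nat. elementary_sum \<Omega> \<nu> (s n)) \<longlonglongrightarrow> signed_integral \<Omega> \<nu> f"
proof -
  let ?M = "restrict_space borel \<Omega>"
  have sp: "space ?M = \<Omega>" by (simp add: space_restrict_space)
  obtain K where K: "\<And>x. x \<in> \<Omega> \<Longrightarrow> \<bar>f x\<bar> \<le> K" and fM: "f \<in> borel_measurable ?M"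
    using f unfolding bounded_measurable_def by blast
  obtain s where s: "\<And>n. simple_function ?M (s n)"
      "\<And>x. x \<in> \<Omega> \<Longrightarrow> (\<lambda>n. s n x) \<longlonglongrightarrow> f x"
      "\<And>n x. x \<in> \<Omega> \<Longrightarrow> norm (s n x) \<le> 2 * norm (f x)"
    using borel_measurable_implies_sequence_metric[OF fM, of 0] by (simp add: sp) metis
  have lev: "{x \<in> \<Omega>. s n x = y} \<in> borel_sets \<Omega>" for n y
    using simple_functionD(2)[OF s(1), of n "{y}"] by (simp add: sp vimage_def Collect_conj_eq Int_commute)
  have pos: "(\<lambda>n. \<Sum>y\<in>s n ` \<Omega>. y * measure (pos_part \<Omega> \<nu>) {x \<in> \<Omega>. s n x = y})
      \<longlonglongrightarrow> integral\<^sup>L (pos_part \<Omega> \<nu>) f" if \<nu>: "signed_measure \<Omega> \<nu>" for \<nu>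
  proof -
    let ?P = "pos_part \<Omega> \<nu>"
    interpret finite_measure ?P by (rule finite_measure_pos_part[OF \<nu>])
    have sf: "simple_function ?P (s n)" for n
      using s(1)[of n] by (simp add: simple_function_def sp space_pos_part sets_pos_part)
    have "Bochner_Integration.simple_bochner_integrable ?P (s n)" for n
      by (rule simple_bochner_integrable.intros[OF sf]) simp
    then have "integral\<^sup>L ?P (s n) = (\<Sum>y\<in>s n ` \<Omega>. y * measure ?P {x \<in> \<Omega>. s n x = y})" for n
      by (simp add: simple_bochner_integrable_eq_integral[symmetric] simple_bochner_integral_def
          space_pos_part mult.commute)
    moreover have "(\<lambda>n. integral\<^sup>L ?P (s n)) \<longlonglongrightarrow> integral\<^sup>L ?P f"
    proof (rule integral_dominated_convergence[where w="\<lambda>_. 2 * K"])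
      show "f \<in> borel_measurable ?P"
        using fM by (simp cong: measurable_cong_sets[OF sets_pos_part refl])
      show "s n \<in> borel_measurable ?P" for n
        using sf by (rule borel_measurable_simple_function)
      show "integrable ?P (\<lambda>_. 2 * K)" by simp
      show "AE x in ?P. (\<lambda>n. s n x) \<longlonglongrightarrow> f x"
        using s(2) by (intro AE_I2) (simp add: space_pos_part)
      show "AE x in ?P. norm (s n x) \<le> 2 * K" for n
        using s(3)[of _ n] K by (intro AE_I2) (fastforce simp: space_pos_part)
    qed
    ultimately show ?thesis by simp
  qed
  have "(\<lambda>n. elementary_sum \<Omega> \<nu> (s n)) \<longlonglongrightarrow> signed_integral \<Omega> \<nu> f"
    if \<nu>: "signed_measure \<Omega> \<nu>" for \<nu>
    using tendsto_diff[OF pos[OF \<nu>] pos[OF signed_measure_uminus[OF \<nu>]]]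
    by (simp add: elementary_sum_def signed_integral_def Jordan_decomposition[OF \<nu> lev]
        sum_subtractf[symmetric] right_diff_distrib)
  then show ?thesis by (intro exI[of _ s] allI impI)
qed

lemma signed_measure_sum:
  assumes "\<And>j. j \<in> J \<Longrightarrow> signed_measure \<Omega> (\<nu> j)"
  shows "signed_measure \<Omega> (\<lambda>A. \<Sum>j\<in>J. c j * \<nu> j A)"
proof (rule signed_measureI, rule sums_sum, rule sums_mult)
  fix A :: "nat \<Rightarrow> (real^2) set" and j
  assume "\<And>n. A n \<in> borel_sets \<Omega>" "disjoint_family A" "j \<in> J"
  then show "(\<lambda>n. \<nu> j (A n)) sums \<nu> j (\<Union>n. A n)"
    using signed_measureD[of \<Omega> "\<nu> j" A] assms by simp
qed

lemma signed_integral_sum_measure: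
  assumes \<nu>: "\<And>j. j \<in> J \<Longrightarrow> signed_measure \<Omega> (\<nu> j)" and f: "bounded_measurable \<Omega> f"
  shows "signed_integral \<Omega> (\<lambda>A. \<Sum>j\<in>J. c j * \<nu> j A) f = (\<Sum>j\<in>J. c j * signed_integral \<Omega> (\<nu> j) f)"
proof -
  from signed_integral_approx[OF f]
  obtain s where "\<forall>\<nu>. signed_measure \<Omega> \<nu> \<longrightarrow>
      (\<lambda>n::nat. elementary_sum \<Omega> \<nu> (s n)) \<longlonglongrightarrow> signed_integral \<Omega> \<nu> f" ..
  note s = this[rule_format]
  have "elementary_sum \<Omega> (\<lambda>A. \<Sum>j\<in>J. c j * \<nu> j A) t = (\<Sum>j\<in>J. c j * elementary_sum \<Omega> (\<nu> j) t)" for t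
    unfolding elementary_sum_def sum_distrib_left
    by (subst sum.swap) (simp add: mult.left_commute)
  moreover have "(\<lambda>n. \<Sum>j\<in>J. c j * elementary_sum \<Omega> (\<nu> j) (s n))
      \<longlonglongrightarrow> (\<Sum>j\<in>J. c j * signed_integral \<Omega> (\<nu> j) f)"
    by (intro tendsto_sum tendsto_mult_left s \<nu>)
  ultimately show ?thesis
    using LIMSEQ_unique[OF s[OF signed_measure_sum[of J \<Omega> \<nu> c, OF \<nu>]]] by simp
qed

section \<open>Orthogonal invariance of the norm\<close>

lemma radon_measureI:
  "(\<And>A. \<lbrakk>\<And>n. A n \<in> borel_sets \<Omega>; disjoint_family A\<rbrakk>
      \<Longrightarrow> (\<lambda>n. \<mu> (A n)) sums \<mu> (\<Union>n::nat. A n))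
    \<Longrightarrow> radon_measure \<Omega> \<mu>"
  by (simp add: radon_measure_def image_subset_iff)

lemma radon_measureD:
  "\<lbrakk>radon_measure \<Omega> \<mu>; \<And>n. A n \<in> borel_sets \<Omega>; disjoint_family A\<rbrakk>
    \<Longrightarrow> (\<lambda>n. \<mu> (A n)) sums \<mu> (\<Union>n::nat. A n)"
  by (simp add: radon_measure_def image_subset_iff)

lemma radon_measure_component:
  "radon_measure \<Omega> \<mu> \<Longrightarrow> signed_measure \<Omega> (\<lambda>A. \<mu> A $ i)"
proof (rule signed_measureI, rule sums_vec_nth)
  fix A :: "nat \<Rightarrow> (real^2) set"
  assume "radon_measure \<Omega> \<mu>" "\<And>n. A n \<in> borel_sets \<Omega>" "disjoint_family A"
  then show "(\<lambda>n. \<mu> (A n)) sums \<mu> (\<Union>n. A n)"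
    by (simp add: radon_measureD[of \<Omega> \<mu> A])
qed

lemma radon_measure_matrix:
  fixes Q :: "real^'d^'d"
  assumes "radon_measure \<Omega> \<mu>"
  shows "radon_measure \<Omega> (\<lambda>A. Q *v \<mu> A)"
proof (rule radon_measureI, rule bounded_linear.sums[OF matrix_vector_mul_bounded_linear])
  fix A :: "nat \<Rightarrow> (real^2) set"
  assume "\<And>n. A n \<in> borel_sets \<Omega>" "disjoint_family A"
  then show "(\<lambda>n. \<mu> (A n)) sums \<mu> (\<Union>n. A n)"
    using assms by (simp add: radon_measureD[of \<Omega> \<mu> A])
qed

lemma test_fun_bounded_measurable:
  assumes "\<phi> \<in> test_fun \<Omega>"
  shows "bounded_measurable \<Omega> \<phi>"
proof -
  have "pds [] \<phi> differentiable (at x)" for x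
    using assms unfolding test_fun_def smooth_def by blast
  then have cont: "continuous_on S \<phi>" for S
    by (intro continuous_at_imp_continuous_on) (auto intro: differentiable_imp_continuous_within)
  then have "bounded (\<phi> ` fsupport \<phi>)"
    using assms by (intro compact_imp_bounded compact_continuous_image) (auto simp: test_fun_def)
  then obtain K where K: "\<And>x. x \<in> fsupport \<phi> \<Longrightarrow> \<bar>\<phi> x\<bar> \<le> K"
    unfolding bounded_iff by auto
  have "\<bar>\<phi> x\<bar> \<le> \<bar>K\<bar>" for x
  proof (cases "\<phi> x = 0")
    case False
    then have "x \<in> fsupport \<phi>"
      unfolding fsupport_def using closure_subset[of "{x. \<phi> x \<noteq> 0}"] by blast
    with K[of x] show ?thesis by linarith
  qed simp
  with borel_measurable_continuous_on_restrict[OF cont] show ?thesis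
    unfolding bounded_measurable_def by blast
qed

lemma signed_integral_matrix:
  fixes Q :: "real^'d^'d"
  assumes \<mu>: "radon_measure \<Omega> \<mu>" and f: "bounded_measurable \<Omega> f"
  shows "signed_integral \<Omega> (\<lambda>A. (Q *v \<mu> A) $ i) f =
    (\<Sum>j\<in>UNIV. Q $ i $ j * signed_integral \<Omega> (\<lambda>A. \<mu> A $ j) f)"
  using signed_integral_sum_measure[where J=UNIV and \<nu>="\<lambda>j A. \<mu> A $ j" and c="\<lambda>j. Q $ i $ j",
      OF radon_measure_component[OF \<mu>] f]
  by (simp add: matrix_vector_mult_def)

lemma dist_of_matrix:
  fixes Q :: "real^'d^'d"
  assumes \<mu>: "radon_measure \<Omega> \<mu>" and \<phi>: "\<phi> \<in> test_fun \<Omega>"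
  shows "dist_of \<Omega> (\<lambda>A. Q *v \<mu> A) \<phi> = Q *v dist_of \<Omega> \<mu> \<phi>"
  by (simp add: vec_eq_iff dist_of_def signed_integral_matrix[OF \<mu> test_fun_bounded_measurable[OF \<phi>]])
    (simp add: matrix_vector_mult_def)

lemma norm_orthogonal_matrix:
  fixes Q :: "real^'d^'d"
  assumes "orthogonal_matrix Q"
  shows "norm (Q *v x) = norm x"
  using assms orthogonal_transformation_matrix[of "(*v) Q"]
  by (simp add: orthogonal_transformation_norm)

text \<open>The pairing of \<open>Q \<mu>\<close> with \<open>\<phi>\<close> equals the pairing of \<open>\<mu>\<close> with the admissible field \<open>Q\<^sup>T \<phi>\<close>.\<close>

lemma measure_norm_matrix_le:
  fixes Q :: "real^'d^'d"
  assumes Q: "orthogonal_matrix Q" and \<mu>: "radon_measure \<Omega> \<mu>"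
  shows "measure_norm \<Omega> (\<lambda>A. Q *v \<mu> A) \<le> measure_norm \<Omega> \<mu>"
  unfolding measure_norm_def
proof (rule SUP_mono)
  fix \<phi> :: "real^2 \<Rightarrow> real^'d"
  assume "\<phi> \<in> {\<phi> \<in> C0 \<Omega>. \<forall>x\<in>\<Omega>. norm (\<phi> x) \<le> 1}"
  then have \<phi>: "continuous_on \<Omega> \<phi>" "\<And>\<epsilon>. \<epsilon> > 0 \<Longrightarrow> compact {x \<in> \<Omega>. \<epsilon> \<le> norm (\<phi> x)}"
      "\<And>x. x \<in> \<Omega> \<Longrightarrow> norm (\<phi> x) \<le> 1"
    by (auto simp: C0_def)
  define \<psi> where "\<psi> = (\<lambda>x. transpose Q *v \<phi> x)"
  have norm\<psi>: "norm (\<psi> x) = norm (\<phi> x)" for x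
    unfolding \<psi>_def using Q by (intro norm_orthogonal_matrix) simp
  have "continuous_on \<Omega> \<psi>"
    unfolding \<psi>_def using \<phi>(1)
    by (rule linear_continuous_on_compose) (rule matrix_vector_mul_linear)
  then have \<psi>: "\<psi> \<in> {\<phi> \<in> C0 \<Omega>. \<forall>x\<in>\<Omega>. norm (\<phi> x) \<le> 1}"
    using \<phi> by (simp add: C0_def norm\<psi>)
  have bm: "bounded_measurable \<Omega> (\<lambda>x. \<phi> x $ i)" for i
    unfolding bounded_measurable_def
  proof
    show "(\<lambda>x. \<phi> x $ i) \<in> borel_measurable (restrict_space borel \<Omega>)"
      using \<phi>(1) by (intro borel_measurable_continuous_on_restrict continuous_intros)
    show "\<exists>K. \<forall>x\<in>\<Omega>. \<bar>\<phi> x $ i\<bar> \<le> K"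
      using \<phi>(3) component_le_norm_cart order_trans by blast
  qed
  let ?S = "\<lambda>j i. signed_integral \<Omega> (\<lambda>A. \<mu> A $ j) (\<lambda>x. \<phi> x $ i)"
  have "(\<Sum>i\<in>UNIV. signed_integral \<Omega> (\<lambda>A. (Q *v \<mu> A) $ i) (\<lambda>x. \<phi> x $ i))
      = (\<Sum>i\<in>UNIV. \<Sum>j\<in>UNIV. Q $ i $ j * ?S j i)"
    by (simp add: signed_integral_matrix[OF \<mu> bm])
  also have "\<dots> = (\<Sum>j\<in>UNIV. \<Sum>i\<in>UNIV. Q $ i $ j * ?S j i)"
    by (rule sum.swap)
  also have "\<dots> = (\<Sum>j\<in>UNIV. signed_integral \<Omega> (\<lambda>A. \<mu> A $ j) (\<lambda>x. \<psi> x $ j))"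
    by (simp add: \<psi>_def matrix_vector_mult_def transpose_def
        signed_integral_sum_fun[OF radon_measure_component[OF \<mu>] bm])
  finally show "\<exists>\<psi>\<in>{\<phi> \<in> C0 \<Omega>. \<forall>x\<in>\<Omega>. norm (\<phi> x) \<le> 1}.
      ereal (\<Sum>i\<in>UNIV. signed_integral \<Omega> (\<lambda>A. (Q *v \<mu> A) $ i) (\<lambda>x. \<phi> x $ i))
      \<le> ereal (\<Sum>i\<in>UNIV. signed_integral \<Omega> (\<lambda>A. \<mu> A $ i) (\<lambda>x. \<psi> x $ i))"
    using \<psi> by (intro bexI[of _ \<psi>]) auto
qed

lemma dist_norm_matrix_le:
  fixes Q :: "real^'d^'d"
  assumes Q: "orthogonal_matrix Q"
  shows "dist_norm \<Omega> (\<lambda>\<phi>. Q *v T \<phi>) \<le> dist_norm \<Omega> T"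
  unfolding dist_norm_def
proof (rule INF_mono)
  fix \<mu> :: "(real^2) set \<Rightarrow> real^'d"
  assume "\<mu> \<in> {\<mu>. radon_measure \<Omega> \<mu> \<and> (\<forall>\<phi>\<in>test_fun \<Omega>. T \<phi> = dist_of \<Omega> \<mu> \<phi>)}"
  then show "\<exists>\<mu>'\<in>{\<mu>. radon_measure \<Omega> \<mu> \<and> (\<forall>\<phi>\<in>test_fun \<Omega>. Q *v T \<phi> = dist_of \<Omega> \<mu> \<phi>)}.
      measure_norm \<Omega> \<mu>' \<le> measure_norm \<Omega> \<mu>"
    using measure_norm_matrix_le[OF Q]
    by (intro bexI[of _ "\<lambda>A. Q *v \<mu> A"]) (auto simp: dist_of_matrix radon_measure_matrix)
qed

text \<open>The reverse inequality is the forward one for \<open>Q\<^sup>T\<close>, the inverse of \<open>Q\<close>.\<close>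

lemma dist_norm_matrix:
  fixes Q :: "real^'d^'d"
  assumes Q: "orthogonal_matrix Q"
  shows "dist_norm \<Omega> (\<lambda>\<phi>. Q *v T \<phi>) = dist_norm \<Omega> T"
proof (rule antisym[OF dist_norm_matrix_le[OF Q]])
  have "transpose Q *v (Q *v x) = x" for x
    using Q by (simp add: orthogonal_matrix_def matrix_vector_mul_assoc)
  then show "dist_norm \<Omega> T \<le> dist_norm \<Omega> (\<lambda>\<phi>. Q *v T \<phi>)"
    using dist_norm_matrix_le[of "transpose Q" \<Omega> "\<lambda>\<phi>. Q *v T \<phi>"] Q by simp
qed

section \<open>The natural gradient as an orthogonal image of the gradient\<close>

text \<open>The rows are curl, divergence and the two shears, read as functionals of the gradient
  \<open>(\<partial>\<^sub>1 w\<^sub>1, \<partial>\<^sub>2 w\<^sub>1, \<partial>\<^sub>1 w\<^sub>2, \<partial>\<^sub>2 w\<^sub>2)\<close>.\<close>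

definition natural_matrix :: "real^4^4" where
  "natural_matrix = (1 / sqrt 2) *\<^sub>R
     vector [vector [ 0, -1, 1, 0],
             vector [ 1,  0, 0, 1],
             vector [-1,  0, 0, 1],
             vector [ 0,  1, 1, 0]]"

lemma vector4_nth [simp]:
  "(vector [a, b, c, d] :: 'a::zero^4) $ 1 = a"
  "(vector [a, b, c, d] :: 'a::zero^4) $ 2 = b"
  "(vector [a, b, c, d] :: 'a::zero^4) $ 3 = c"
  "(vector [a, b, c, d] :: 'a::zero^4) $ 4 = d"
  by (simp_all add: vector_def)

lemma orthogonal_natural_matrix: "orthogonal_matrix natural_matrix"
  unfolding orthogonal_matrix
  by (simp add: vec_eq_iff forall_4 natural_matrix_def matrix_matrix_mult_def transpose_def
      mat_def sum_4 real_sqrt_mult[symmetric])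

lemma natural_matrix_full_grad:
  "natural_matrix *v full_grad w \<phi> =
    diag (vector [1 / sqrt 2, 1 / sqrt 2, 1 / sqrt 2, 1 / sqrt 2]) *v grad_N w \<phi>"
  by (simp add: vec_eq_iff forall_4 natural_matrix_def matrix_vector_mult_def sum_4 diag_def
      full_grad_def grad_N_def dcurl_def ddiv_def sh1_def sh2_def field_simps)

text \<open>The second and third entries of \<open>sym_grad\<close> agree, so the curl row annihilates it, which is why
  the first weight is \<open>0\<close>; the other three rows do not see the symmetrisation.\<close>

lemma natural_matrix_sym_grad:
  "natural_matrix *v sym_grad w \<phi> =
    diag (vector [0, 1 / sqrt 2, 1 / sqrt 2, 1 / sqrt 2]) *v grad_N w \<phi>"
proof -
  have sqrt2_sqrt2: "sqrt 2 * (sqrt 2 * x) = 2 * x" for x :: real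
    by (simp flip: mult.assoc)
  show ?thesis
    by (simp add: vec_eq_iff forall_4 natural_matrix_def matrix_vector_mult_def sum_4 diag_def
        sym_grad_def grad_N_def dcurl_def ddiv_def sh1_def sh2_def field_simps sqrt2_sqrt2)
qed

theorem mainTheorem5:
  fixes \<Omega> :: "(real^2) set"
  assumes "is_domain \<Omega>" and "bounded \<Omega>" and "lipschitz_boundary \<Omega>"
  shows "(\<forall>u. distribution \<Omega> u \<longrightarrow>
            TGV \<Omega> u = R \<Omega> (vector [0, 1 / sqrt 2, 1 / sqrt 2, 1 / sqrt 2]) u) \<and>
         (\<forall>u. distribution \<Omega> u \<longrightarrow>
            TGVF \<Omega> u = R \<Omega> (vector [1 / sqrt 2, 1 / sqrt 2, 1 / sqrt 2, 1 / sqrt 2]) u)"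
  by (simp add: TGV_def TGVF_def R_def dist_norm_matrix[OF orthogonal_natural_matrix]
      flip: natural_matrix_full_grad natural_matrix_sym_grad)

end
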